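(* Assume the standing assumptions below with $\beta>0$, and let $(\theta^k,u^k,w^k)\in H^1(\Omega)\times\mathcal K\times V_A$ solve one step (D1)–(D3) of the time-discrete scheme. Set $g^k:=w^k+\gamma*u^k+c_Fm(\theta^{k-1})-c_F/2$. If $\xi>0$, then a.e. in $\Omega$ $$u^k=P_{[0,1]}\Big(\frac{g^k}{\xi}\Big)=\begin{cases}1,& g^k\ge\xi,\\ 0,& g^k\le 0,\\ g^k/\xi,& g^k\in(0,\xi).\end{cases}$$ If $\xi=0$, then a.e. in $\Omega$: $u^k=1$ where $g^k>0$, $u^k=0$ where $g^k<0$, and $u^k\in[0,1]$ where $g^k=0$. In particular, if $\xi=0$ and the set $\{x\in\Omega:g^k(x)=0\}$ has Lebesgue measure zero, then $u^k(x)\in\{0,1\}$ for a.e. $x\in\Omega$.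
   Context: Standing assumptions. $\Omega\subset\mathbb{R}^n$, $n\le 3$, bounded domain. Kernel $\gamma:\mathbb{R}^n\to[0,\infty)$ with $\gamma\in L^1(\mathbb{R}^n)$, $\gamma(x)=\hat\gamma(|x|)$, $(0,\sigma)\subset\operatorname{supp}\hat\gamma\subset(0,\delta]$ for some $\sigma,\delta>0$. $\Omega_I=\{y\in\mathbb{R}^n\setminus\Omega:\gamma(x-y)\ne0\text{ for some }x\in\Omega\}$; functions are extended by zero outside $\Omega\cup\Omega_I$, and $\gamma*u(x)=\int_{\Omega\cup\Omega_I}\gamma(x-y)u(y)dy$. $c_\gamma=\int_{\Omega\cup\Omega_I}\gamma(x-y)dy$ (constant for $x\in\Omega$). $Bu(x)=\int_{\Omega\cup\Omega_I}(u(x)-u(y))\gamma(x-y)dy=c_\gamma u-\gamma*u$; $\mathcal N u$ is the same integral for $x\in\Omega_I$. $V_B=\{v\in L^2(\Omega\cup\Omega_I):\mathcal Nv=0\text{ on }\Omega_I\}$, $\mathcal K=\{v\in V_B:0\le v\le1\text{ a.e. in }\Omega\}$. $(\cdot,\cdot)$ is the $L^2(\Omega)$ inner product. $V_A=L^2(\Omega)$ if $\beta=0$, $V_A=H^1(\Omega)$ if $\beta>0$. Parameters $D>0$, $L\in\mathbb{R}$, $\mu>0$, $c_F>0$, $\beta\ge0$, $\tau>0$, $\xi:=c_\gamma-c_F$; $m:\mathbb{R}\to\mathbb{R}$ with $|m|\le1/2$, $|m'|\le C_m$. Time-discrete scheme: given $\theta^{k-1}\in H^1(\Omega)$ and $u^{k-1}\in\mathcal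 K$, find $(\theta^k,u^k,w^k)\in H^1(\Omega)\times\mathcal K\times V_A$ with (D1) $(\theta^k-\theta^{k-1},\phi)+D\tau(\nabla\theta^k,\nabla\phi)-L(u^k-u^{k-1},\phi)=0$ for all $\phi\in H^1(\Omega)$; (D2) $\mu(u^k-u^{k-1},\psi)+\tau(w^k,\psi)+\beta\tau(\nabla w^k,\nabla\psi)=0$ for all $\psi\in V_A$; (D3) $(Bu^k-c_Fu^k+c_F/2-c_Fm(\theta^{k-1})-w^k,\zeta-u^k)\ge0$ for all $\zeta\in\mathcal K$. $P_{[0,1]}(s)=\min\{1,\max\{0,s\}\}$ pointwise. *)

theory Defs
  imports "HOL-Analysis.Analysis"
begin

text \<open>Points of R^n are of type real^'n. Functions on subsets are total functions
  whose values outside the relevant set are irrelevant.\<close>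

definition L2_on :: "(real^'n::finite) set \<Rightarrow> (real^'n \<Rightarrow> real) \<Rightarrow> bool" where
  "L2_on S u \<longleftrightarrow> set_borel_measurable lebesgue S u \<and>
                  set_integrable lebesgue S (\<lambda>x. (u x)\<^sup>2)"

definition interaction_domain :: "(real^'n::finite) set \<Rightarrow> (real^'n \<Rightarrow> real) \<Rightarrow> (real^'n) set" where
  "interaction_domain \<Omega> \<gamma> = {y. y \<notin> \<Omega> \<and> (\<exists>x\<in>\<Omega>. \<gamma> (x - y) \<noteq> 0)}"

text \<open>c_gamma: the integral of gamma(x - y) over Omega \<union> Omega_I, which for x in Omega equals
  the integral of gamma over the whole space.\<close>
definition c_gamma :: "(real^'n::finite \<Rightarrow> real) \<Rightarrow> real" where
  "c_gamma \<gamma> = (LINT y|lebesgue. \<gamma> y)"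

definition conv :: "(real^'n::finite) set \<Rightarrow> (real^'n \<Rightarrow> real) \<Rightarrow> (real^'n \<Rightarrow> real) \<Rightarrow> real^'n \<Rightarrow> real" where
  "conv \<Omega> \<gamma> u x = (LINT y:(\<Omega> \<union> interaction_domain \<Omega> \<gamma>)|lebesgue. \<gamma> (x - y) * u y)"

text \<open>The nonlocal operator: B u (x) for x in Omega, N u (x) for x in Omega_I (same formula).\<close>
definition nonlocal_op :: "(real^'n::finite) set \<Rightarrow> (real^'n \<Rightarrow> real) \<Rightarrow> (real^'n \<Rightarrow> real) \<Rightarrow> real^'n \<Rightarrow> real" where
  "nonlocal_op \<Omega> \<gamma> u x = (LINT y:(\<Omega> \<union> interaction_domain \<Omega> \<gamma>)|lebesgue. (u x - u y) * \<gamma> (x - y))"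

definition V_B :: "(real^'n::finite) set \<Rightarrow> (real^'n \<Rightarrow> real) \<Rightarrow> (real^'n \<Rightarrow> real) set" where
  "V_B \<Omega> \<gamma> = {v. L2_on (\<Omega> \<union> interaction_domain \<Omega> \<gamma>) v \<and>
        (AE x in lebesgue. x \<in> interaction_domain \<Omega> \<gamma> \<longrightarrow> nonlocal_op \<Omega> \<gamma> v x = 0)}"

definition K_set :: "(real^'n::finite) set \<Rightarrow> (real^'n \<Rightarrow> real) \<Rightarrow> (real^'n \<Rightarrow> real) set" where
  "K_set \<Omega> \<gamma> = {v \<in> V_B \<Omega> \<gamma>. AE x in lebesgue. x \<in> \<Omega> \<longrightarrow> 0 \<le> v x \<and> v x \<le> 1}"

definition ip :: "(real^'n::finite) set \<Rightarrow> (real^'n \<Rightarrow> real) \<Rightarrow> (real^'n \<Rightarrow> real) \<Rightarrow> real" where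
  "ip \<Omega> f g = (LINT x:\<Omega>|lebesgue. f x * g x)"

definition ip_vec :: "(real^'n::finite) set \<Rightarrow> (real^'n \<Rightarrow> real^'n) \<Rightarrow> (real^'n \<Rightarrow> real^'n) \<Rightarrow> real" where
  "ip_vec \<Omega> F G = (LINT x:\<Omega>|lebesgue. F x \<bullet> G x)"

definition test_fun :: "(real^'n::finite) set \<Rightarrow> (real^'n \<Rightarrow> real) \<Rightarrow> (real^'n \<Rightarrow> real^'n) \<Rightarrow> bool" where
  "test_fun \<Omega> \<phi> d\<phi> \<longleftrightarrow>
     (\<forall>x. (\<phi> has_derivative (\<lambda>h. d\<phi> x \<bullet> h)) (at x)) \<and> continuous_on UNIV d\<phi> \<and>
     compact (closure {x. \<phi> x \<noteq> 0}) \<and> closure {x. \<phi> x \<noteq> 0} \<subseteq> \<Omega>"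

definition weak_grad :: "(real^'n::finite) set \<Rightarrow> (real^'n \<Rightarrow> real) \<Rightarrow> (real^'n \<Rightarrow> real^'n) \<Rightarrow> bool" where
  "weak_grad \<Omega> u G \<longleftrightarrow>
     (\<forall>\<phi> d\<phi>. test_fun \<Omega> \<phi> d\<phi> \<longrightarrow>
        (\<forall>i. (LINT x:\<Omega>|lebesgue. u x * d\<phi> x $ i) = - (LINT x:\<Omega>|lebesgue. G x $ i * \<phi> x)))"

definition H1_grad :: "(real^'n::finite) set \<Rightarrow> (real^'n \<Rightarrow> real) \<Rightarrow> (real^'n \<Rightarrow> real^'n) \<Rightarrow> bool" where
  "H1_grad \<Omega> u G \<longleftrightarrow> L2_on \<Omega> u \<and> (\<forall>i. L2_on \<Omega> (\<lambda>x. G x $ i)) \<and> weak_grad \<Omega> u G"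

definition proj01 :: "real \<Rightarrow> real" where
  "proj01 s = min 1 (max 0 s)"

end

theory Submission
  imports Defs
begin

text \<open>
  Almost everywhere in \<open>\<Omega>\<close> the integrand of the variational inequality (D3) is \<open>F = \<xi> u - g\<close>, which is
  integrable by Young's inequality. Testing with a \<open>\<zeta>\<close> that equals the indicator of \<open>{F < 0}\<close> on \<open>\<Omega>\<close>
  makes \<open>F (\<zeta> - u)\<close> nonpositive with nonnegative integral, hence zero a.e., so \<open>u = 1\<close> where \<open>F < 0\<close> and
  \<open>u = 0\<close> where \<open>F > 0\<close>; all claims follow pointwise. Such a \<open>\<zeta>\<close> must satisfy the nonlocal Neumann
  condition on the interaction domain; it is the limit of the monotone iteration that replaces the values
  there by \<open>\<gamma>\<close>-weighted averages.
\<close>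

section \<open>Reflections and convolutions of Borel functions\<close>

lemma lborel_distr_reflect:
  fixes x :: "'a::euclidean_space"
  shows "distr lborel borel (\<lambda>y. x - y) = lborel"
  by (subst (2) lborel_affine[of "-1" x]) (auto simp: density_1)

lemma AE_lborel_reflect:
  fixes x :: "'a::euclidean_space"
  assumes "AE y in lborel. P y"
  shows "AE y in lborel. P (x - y)"
proof -
  have "AE y in distr lborel borel (\<lambda>y. x - y). P y"
    unfolding lborel_distr_reflect by (rule assms)
  then show ?thesis
    by (rule AE_distrD[rotated]) simp
qed

lemma lborel_reflect:
  fixes x :: "'a::euclidean_space" and f :: "'a \<Rightarrow> real"
  assumes f [measurable]: "f \<in> borel_measurable borel"
  shows integrable_lborel_reflect: "integrable lborel (\<lambda>y. f (x - y)) \<longleftrightarrow> integrable lborel f"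
    and integral_lborel_reflect: "(LINT y|lborel. f (x - y)) = (LINT y|lborel. f y)"
proof -
  show "integrable lborel (\<lambda>y. f (x - y)) \<longleftrightarrow> integrable lborel f"
    using integrable_distr_eq[of "\<lambda>y. x - y" lborel borel f] by (simp add: lborel_distr_reflect)
  show "(LINT y|lborel. f (x - y)) = (LINT y|lborel. f y)"
    using integral_distr[of "\<lambda>y. x - y" lborel borel f] by (simp add: lborel_distr_reflect)
qed

text \<open>Young's inequality for two L1 functions, by Fubini: translation invariance turns the
  double integral of \<open>\<bar>k (x - y) * u y\<bar>\<close> into the product of the two L1
  norms. It controls \<open>\<gamma>*u\<close> without any higher integrability of the
  kernel.\<close>

lemma integrable_convolution:
  fixes k u :: "'a::euclidean_space \<Rightarrow> real"
  assumes k: "integrable lborel k" and u: "integrable lborel u"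
  shows "AE x in lborel. integrable lborel (\<lambda>y. k (x - y) * u y)"
    and "integrable lborel (\<lambda>x. LINT y|lborel. k (x - y) * u y)"
proof -
  have [measurable]: "k \<in> borel_measurable borel" "u \<in> borel_measurable borel"
    using k u by auto
  have shift: "integrable lborel (\<lambda>x. f (x - y))" "(LINT x|lborel. f (x - y)) = (LINT x|lborel. f x)"
    if "integrable lborel f" for y and f :: "'a \<Rightarrow> real"
  proof -
    have [measurable]: "f \<in> borel_measurable borel" using that by auto
    have d: "distr lborel borel (\<lambda>x. x - y) = lborel"
    proof -
      have "(\<lambda>x. x - y) = (+) (- y)" by auto
      then show ?thesis by (simp add: lborel_distr_plus)
    qed
    show "integrable lborel (\<lambda>x. f (x - y))"
      using integrable_distr_eq[of "\<lambda>x. x - y" lborel borel f] that by (simp add: d)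
    show "(LINT x|lborel. f (x - y)) = (LINT x|lborel. f x)"
      using integral_distr[of "\<lambda>x. x - y" lborel borel f] by (simp add: d)
  qed
  \<comment> \<open>The pair is ordered \<open>(y, x)\<close> so that the inner integral runs over
    \<open>x\<close>: for fixed \<open>y\<close> it is a translate of \<open>k\<close>, integrable
    for every \<open>y\<close>. The sections needed in the conclusions are those in
    \<open>y\<close>, hence the swap afterwards.\<close>
  have "integrable (lborel \<Otimes>\<^sub>M lborel) (\<lambda>(y, x). k (x - y) * u y)"
  proof (rule lborel_pair.Fubini_integrable)
    show "(\<lambda>(y, x). k (x - y) * u y) \<in> borel_measurable (lborel \<Otimes>\<^sub>M lborel)"
      by measurable
    have "integrable lborel (\<lambda>y. (LINT x|lborel. \<bar>k x\<bar>) * \<bar>u y\<bar>)"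
      using u by auto
    moreover have "(LINT x|lborel. \<bar>k (x - y)\<bar>) = (LINT x|lborel. \<bar>k x\<bar>)" for y
      using shift(2)[of "\<lambda>x. \<bar>k x\<bar>" y] k by auto
    ultimately show "integrable lborel (\<lambda>y. LINT x|lborel. norm (case (y, x) of (y, x) \<Rightarrow> k (x - y) * u y))"
      by (simp add: abs_mult)
    show "AE y in lborel. integrable lborel (\<lambda>x. case (y, x) of (y, x) \<Rightarrow> k (x - y) * u y)"
      using shift(1)[OF k] by auto
  qed
  from lborel_pair.integrable_product_swap[OF this]
  have *: "integrable (lborel \<Otimes>\<^sub>M lborel) (\<lambda>(x, y). k (x - y) * u y)"
    by (simp add: case_prod_unfold)
  show "AE x in lborel. integrable lborel (\<lambda>y. k (x - y) * u y)"
    using lborel_pair.AE_integrable_fst'[OF *] by simp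
  show "integrable lborel (\<lambda>x. LINT y|lborel. k (x - y) * u y)"
    using lborel_pair.integrable_fst'[OF *] by simp
qed

section \<open>Extension by the nonlocal Neumann condition\<close>

text \<open>Outside \<open>W\<close> the Neumann condition reads
  \<open>v x * c x = (LINT y|lborel. indicator S y * k (x - y) * v y)\<close>, so \<open>v\<close>
  is sought as a fixed point of the averaging map \<open>T\<close>. This map is monotone and keeps
  values in [0,1]; its iterates therefore increase to a pointwise limit, and dominated convergence
  shows that the limit is fixed.\<close>

lemma neumann_extension:
  fixes k \<eta> :: "'a::euclidean_space \<Rightarrow> real"
  assumes [measurable]: "S \<in> sets borel" "W \<in> sets borel"
    and k: "integrable lborel k" "\<And>x. 0 \<le> k x"
    and \<eta> [measurable]: "\<eta> \<in> borel_measurable borel" and \<eta>01: "\<And>x. 0 \<le> \<eta> x \<and> \<eta> x \<le> 1"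
  obtains v where "v \<in> borel_measurable borel" "\<And>x. 0 \<le> v x \<and> v x \<le> 1"
    "\<And>x. x \<in> W \<Longrightarrow> v x = \<eta> x"
    "\<And>x. x \<notin> W \<Longrightarrow> (LINT y:S|lborel. (v x - v y) * k (x - y)) = 0"
proof -
  have [measurable]: "k \<in> borel_measurable borel"
    using k by auto
  define c where "c x = (LINT y|lborel. indicator S y * k (x - y))" for x
  \<comment> \<open>Where \<open>c x = 0\<close>, division by zero gives \<open>T v x = 0\<close>; this is harmless since then the
    kernel vanishes a.e. on \<open>S\<close> and the Neumann condition at \<open>x\<close> is void.\<close>
  define T where "T v x = (if x \<in> W then \<eta> x else (LINT y|lborel. indicator S y * k (x - y) * v y) / c x)"
    for v :: "'a \<Rightarrow> real" and x
  have ik: "integrable lborel (\<lambda>y. indicator S y * k (x - y))" for x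
    using k(1) by (intro integrable_mult_indicator[where 'b=real, simplified]) (auto simp: integrable_lborel_reflect)
  have ikv: "integrable lborel (\<lambda>y. indicator S y * k (x - y) * v y)"
    if [measurable]: "v \<in> borel_measurable borel" and "\<And>y. 0 \<le> v y \<and> v y \<le> 1" for v x
    by (rule Bochner_Integration.integrable_bound[OF ik[of x]])
      (use that k in \<open>auto simp: abs_mult mult_left_le\<close>)
  have c_nonneg: "0 \<le> c x" for x
    unfolding c_def using k by (intro integral_nonneg_AE) auto
  \<comment> \<open>Zero outside \<open>W\<close> gives the smallest function with values in [0,1]
    that agrees with \<eta> on \<open>W\<close>, so the first application of \<open>T\<close> can
    only increase it; monotonicity of \<open>T\<close> carries this to all later steps.\<close>
  define V where "V j = (T ^^ j) (\<lambda>x. if x \<in> W then \<eta> x else 0)" for j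
  have [measurable]: "c \<in> borel_measurable borel"
    unfolding c_def by measurable
  have T_meas: "T v \<in> borel_measurable borel" if [measurable]: "v \<in> borel_measurable borel" for v
    unfolding T_def by measurable
  have V_meas [measurable]: "V j \<in> borel_measurable borel" for j
    by (induction j) (auto simp: V_def intro!: T_meas)
  have int_nonneg: "0 \<le> (LINT y|lborel. indicator S y * k (x - y) * v y)" if "\<And>y. 0 \<le> v y" for v x
    using k that by (intro integral_nonneg_AE) auto
  have T01: "0 \<le> T v x \<and> T v x \<le> 1" if [measurable]: "v \<in> borel_measurable borel" and v: "\<And>y. 0 \<le> v y \<and> v y \<le> 1" for v x
  proof -
    have "(LINT y|lborel. indicator S y * k (x - y) * v y) \<le> c x"
      unfolding c_def using v k by (intro integral_mono ikv ik) (auto simp: mult_left_le)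
    then show ?thesis
      using \<eta>01 c_nonneg[of x] int_nonneg[of v x] v by (auto simp: T_def divide_le_eq_1)
  qed
  have V01: "0 \<le> V j x \<and> V j x \<le> 1" for j x
  proof (induction j arbitrary: x)
    case (Suc j) then show ?case using T01[OF V_meas, of j x] by (simp add: V_def)
  qed (use \<eta>01 in \<open>auto simp: V_def\<close>)
  have VSuc: "V (Suc j) = T (V j)" for j
    by (simp add: V_def)
  have T_mono: "T v x \<le> T w x"
    if [measurable]: "v \<in> borel_measurable borel" "w \<in> borel_measurable borel"
      and v: "\<And>y. 0 \<le> v y \<and> v y \<le> 1" and w: "\<And>y. 0 \<le> w y \<and> w y \<le> 1" and "\<And>y. v y \<le> w y" for v w x
    using that k c_nonneg[of x]
    by (auto simp: T_def intro!: divide_right_mono integral_mono ikv mult_left_mono)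
  have V_mono: "V j x \<le> V (Suc j) x" for j x
  proof (induction j arbitrary: x)
    case 0 show ?case
      using T01[OF V_meas[of 0] V01, of x] by (cases "x \<in> W") (simp_all add: V_def T_def)
  next
    case (Suc j) then show ?case
      using T_mono[OF V_meas V_meas V01 V01, of j "Suc j" x] by (simp add: VSuc)
  qed
  define v where "v x = lim (\<lambda>j. V j x)" for x
  have v_lim: "(\<lambda>j. V j x) \<longlonglongrightarrow> v x" for x
  proof -
    have "incseq (\<lambda>j. V j x)" using V_mono by (intro incseq_SucI) auto
    then have "convergent (\<lambda>j. V j x)"
      using V01 by (intro Bseq_mono_convergent BseqI'[where K=1]) (auto simp: incseq_def)
    then show ?thesis by (simp add: v_def convergent_LIMSEQ_iff)
  qed
  have v_meas [measurable]: "v \<in> borel_measurable borel"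
    unfolding v_def by measurable
  have v01: "0 \<le> v x \<and> v x \<le> 1" for x
    using v_lim[of x] V01 by (auto intro: LIMSEQ_le_const LIMSEQ_le_const2)
  have T_lim: "(\<lambda>j. T (V j) x) \<longlonglongrightarrow> T v x" for x
  proof (cases "c x = 0 \<or> x \<in> W")
    case True then show ?thesis by (auto simp: T_def)
  next
    case False
    have "(\<lambda>j. LINT y|lborel. indicator S y * k (x - y) * V j y) \<longlonglongrightarrow> (LINT y|lborel. indicator S y * k (x - y) * v y)"
      by (rule integral_dominated_convergence[where w="\<lambda>y. indicator S y * k (x - y)"])
        (use V01 k ik in \<open>auto intro!: tendsto_intros v_lim simp: abs_mult mult_left_le\<close>)
    then show ?thesis using False by (auto simp: T_def intro!: tendsto_intros)
  qed
  \<comment> \<open>The shifted sequence \<open>V (Suc j) x\<close> is \<open>T (V j) x\<close>, so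
    it converges both to \<open>v x\<close> and to \<open>T v x\<close>.\<close>
  have fix_v: "v x = T v x" for x
    using LIMSEQ_unique[OF LIMSEQ_Suc[OF v_lim, unfolded VSuc] T_lim] .
  show thesis
  proof (rule that[of v])
    show "v x = \<eta> x" if "x \<in> W" for x
      using that by (subst fix_v) (simp add: T_def)
    show "(LINT y:S|lborel. (v x - v y) * k (x - y)) = 0" if "x \<notin> W" for x
    proof (cases "c x = 0")
      case True
      then have "AE y in lborel. indicator S y * k (x - y) = 0"
        using integral_nonneg_eq_0_iff_AE[OF ik[of x]] k unfolding c_def by auto
      then show ?thesis
        unfolding set_lebesgue_integral_def
        by (intro integral_eq_zero_AE) (auto simp: indicator_def)
    next
      case False
      have "(LINT y:S|lborel. (v x - v y) * k (x - y))
          = (LINT y|lborel. v x * (indicator S y * k (x - y)) - indicator S y * k (x - y) * v y)"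
        unfolding set_lebesgue_integral_def
        by (intro Bochner_Integration.integral_cong) (auto simp: algebra_simps)
      also have "\<dots> = v x * c x - (LINT y|lborel. indicator S y * k (x - y) * v y)"
        using ik[of x] ikv[OF v_meas v01, of x]
        by (subst Bochner_Integration.integral_diff) (auto simp: c_def)
      also have "\<dots> = 0"
        using fix_v[of x] that False by (simp add: T_def)
      finally show ?thesis .
    qed
  qed (use v01 v_meas in auto)
qed

section \<open>Transfer from Borel to Lebesgue measurable functions\<close>

text \<open>The Fubini and substitution arguments are carried out for Borel functions, whereas the
  data are only Lebesgue measurable. Passing to an a.e. equal Borel representative bridges the
  two.\<close>

lemma lebesgue_eq_borel_AE:
  fixes f :: "'a::euclidean_space \<Rightarrow> real"
  assumes f': "f' \<in> borel_measurable borel" and ae: "AE x in lborel. f x = f' x"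
  shows borel_measurable_lebesgue_eq_borel_AE: "f \<in> borel_measurable lebesgue"
    and integrable_lebesgue_eq_borel_AE: "integrable lebesgue f \<longleftrightarrow> integrable lborel f'"
    and integral_lebesgue_eq_borel_AE: "(LINT x|lebesgue. f x) = (LINT x|lborel. f' x)"
proof -
  have ae': "AE x in lebesgue. f x = f' x"
    using ae by (rule AE_completion)
  have [measurable]: "f' \<in> borel_measurable lebesgue"
    using f' by (intro measurable_completion) simp
  show [measurable]: "f \<in> borel_measurable lebesgue"
    by (rule borel_measurable_AE[of f']) (use ae' in auto)
  show "integrable lebesgue f \<longleftrightarrow> integrable lborel f'"
    using integrable_cong_AE[OF _ _ ae'] f' by (simp add: integrable_completion)
  show "(LINT x|lebesgue. f x) = (LINT x|lborel. f' x)"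
    using integral_cong_AE[OF _ _ ae'] f' by (simp add: integral_completion)
qed

lemma obtain_borel_representative:
  fixes f :: "'a::euclidean_space \<Rightarrow> real"
  assumes "f \<in> borel_measurable lebesgue"
  obtains f' where "f' \<in> borel_measurable borel" "AE x in lborel. f x = f' x"
  using completion_ex_borel_measurable_real[OF assms] that by auto

lemma integral_lebesgue_reflect:
  fixes f :: "'a::euclidean_space \<Rightarrow> real"
  assumes "integrable lebesgue f"
  shows "integrable lebesgue (\<lambda>y. f (x - y))"
    and "(LINT y|lebesgue. f (x - y)) = (LINT y|lebesgue. f y)"
proof -
  obtain f' where f' [measurable]: "f' \<in> borel_measurable borel" and ae: "AE y in lborel. f y = f' y"
    using obtain_borel_representative assms by blast
  have refl: "(\<lambda>y. f' (x - y)) \<in> borel_measurable borel" by measurable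
  note refl_ae = AE_lborel_reflect[OF ae, of x]
  show "integrable lebesgue (\<lambda>y. f (x - y))"
    using assms integrable_lebesgue_eq_borel_AE[OF f' ae] integrable_lebesgue_eq_borel_AE[OF refl refl_ae]
      integrable_lborel_reflect[OF f'] by simp
  show "(LINT y|lebesgue. f (x - y)) = (LINT y|lebesgue. f y)"
    using integral_lebesgue_eq_borel_AE[OF f' ae] integral_lebesgue_eq_borel_AE[OF refl refl_ae]
      integral_lborel_reflect[OF f'] by simp
qed

text \<open>Reflection preserves null sets, so for every fixed \<open>x\<close> Borel
  representatives of \<open>k\<close> and \<open>u\<close> change the integrand in \<open>y\<close>
  only on a null set. The two convolutions thus agree at every point, not just almost
  everywhere.\<close>

lemma integrable_lebesgue_convolution:
  fixes k u :: "'a::euclidean_space \<Rightarrow> real"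
  assumes k: "integrable lebesgue k" and u: "integrable lebesgue u"
  shows "AE x in lebesgue. integrable lebesgue (\<lambda>y. k (x - y) * u y)"
    and "integrable lebesgue (\<lambda>x. LINT y|lebesgue. k (x - y) * u y)"
proof -
  obtain k' where k' [measurable]: "k' \<in> borel_measurable borel" and ae_k: "AE y in lborel. k y = k' y"
    using obtain_borel_representative k by blast
  obtain u' where u' [measurable]: "u' \<in> borel_measurable borel" and ae_u: "AE y in lborel. u y = u' y"
    using obtain_borel_representative u by blast
  have ik: "integrable lborel k'" and iu: "integrable lborel u'"
    using integrable_lebesgue_eq_borel_AE[OF k' ae_k] integrable_lebesgue_eq_borel_AE[OF u' ae_u] k u by auto
  have m: "(\<lambda>y. k' (x - y) * u' y) \<in> borel_measurable borel" for x
    by measurable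
  have ae: "AE y in lborel. k (x - y) * u y = k' (x - y) * u' y" for x
    using AE_lborel_reflect[OF ae_k, of x] ae_u by eventually_elim simp
  show "AE x in lebesgue. integrable lebesgue (\<lambda>y. k (x - y) * u y)"
    unfolding integrable_lebesgue_eq_borel_AE[OF m ae]
    by (rule AE_completion) (rule integrable_convolution[OF ik iu])
  have "(\<lambda>x. LINT y|lebesgue. k (x - y) * u y) = (\<lambda>x. LINT y|lborel. k' (x - y) * u' y)"
    using integral_lebesgue_eq_borel_AE[OF m ae] by auto
  then show "integrable lebesgue (\<lambda>x. LINT y|lebesgue. k (x - y) * u y)"
    using integrable_convolution(2)[OF ik iu] by (simp add: integrable_completion borel_measurable_integrable)
qed

text \<open>Changing \<eta> to a representative costs a null set in \<open>W\<close>, but changing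
  \<open>k\<close> alters each integral over \<open>y\<close> only on a null set. Hence the values
  on \<open>W\<close> are attained a.e. while the Neumann condition still holds at every point
  outside \<open>W\<close>.\<close>

lemma neumann_extension_lebesgue:
  fixes k \<eta> :: "'a::euclidean_space \<Rightarrow> real"
  assumes S [measurable]: "S \<in> sets borel" and W: "W \<in> sets borel"
    and k: "integrable lebesgue k" "\<And>x. 0 \<le> k x"
    and \<eta>: "\<eta> \<in> borel_measurable lebesgue" and \<eta>01: "\<And>x. 0 \<le> \<eta> x \<and> \<eta> x \<le> 1"
  obtains v where "v \<in> borel_measurable borel" "\<And>x. 0 \<le> v x \<and> v x \<le> 1"
    "AE x in lebesgue. x \<in> W \<longrightarrow> v x = \<eta> x"
    "\<And>x. x \<notin> W \<Longrightarrow> (LINT y:S|lebesgue. (v x - v y) * k (x - y)) = 0"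
proof -
  obtain k' where k' [measurable]: "k' \<in> borel_measurable borel" and ae_k: "AE y in lborel. k y = k' y"
    using obtain_borel_representative k by blast
  obtain \<eta>' where \<eta>' [measurable]: "\<eta>' \<in> borel_measurable borel" and ae_\<eta>: "AE y in lborel. \<eta> y = \<eta>' y"
    using obtain_borel_representative \<eta> by blast
  \<comment> \<open>A Borel representative may violate the sign or range bounds on a null set. The
    absolute value here, and below the clamping of \<open>\<eta>'\<close> to [0,1], restore them
    everywhere.\<close>
  have ae_k': "AE y in lborel. k y = \<bar>k' y\<bar>"
    using ae_k by eventually_elim (metis abs_of_nonneg k(2))
  have m: "(\<lambda>y. \<bar>k' y\<bar>) \<in> borel_measurable borel" by measurable
  have ik: "integrable lborel (\<lambda>y. \<bar>k' y\<bar>)"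
    using integrable_lebesgue_eq_borel_AE[OF m ae_k'] k by auto
  obtain v where v [measurable]: "v \<in> borel_measurable borel" and v01: "\<And>x. 0 \<le> v x \<and> v x \<le> 1"
    and vW: "\<And>x. x \<in> W \<Longrightarrow> v x = max 0 (min 1 (\<eta>' x))"
    and vN: "\<And>x. x \<notin> W \<Longrightarrow> (LINT y:S|lborel. (v x - v y) * \<bar>k' (x - y)\<bar>) = 0"
    using neumann_extension[OF S W ik, of "\<lambda>x. max 0 (min 1 (\<eta>' x))"] by auto
  show thesis
  proof (rule that[OF v v01])
    have "AE x in lborel. x \<in> W \<longrightarrow> v x = \<eta> x"
      using ae_\<eta> by eventually_elim (metis vW \<eta>01 max.absorb2 min.absorb2)
    then show "AE x in lebesgue. x \<in> W \<longrightarrow> v x = \<eta> x"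
      by (rule AE_completion)
    fix x assume "x \<notin> W"
    have "AE y in lborel. indicator S y *\<^sub>R ((v x - v y) * k (x - y))
        = indicator S y *\<^sub>R ((v x - v y) * \<bar>k' (x - y)\<bar>)"
      using AE_lborel_reflect[OF ae_k', of x] by eventually_elim simp
    moreover have "(\<lambda>y. indicator S y *\<^sub>R ((v x - v y) * \<bar>k' (x - y)\<bar>)) \<in> borel_measurable borel"
      by measurable
    ultimately show "(LINT y:S|lebesgue. (v x - v y) * k (x - y)) = 0"
      using vN[OF \<open>x \<notin> W\<close>] unfolding set_lebesgue_integral_def
      by (subst integral_lebesgue_eq_borel_AE)
  qed
qed

section \<open>Pointwise consequences of the variational inequality\<close>

text \<open>For each \<open>x\<close> the indicator of \<open>{F < 0}\<close> minimizes
  \<open>F x * t\<close> over \<open>t\<close> in [0,1], so among admissible test functions it makes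
  the integral smallest. Testing with indicators alone is therefore enough.\<close>

lemma complementarity_of_variational_inequality:
  fixes F u :: "'a \<Rightarrow> real"
  assumes W [measurable]: "W \<in> sets M" and F: "set_integrable M W F" and u: "set_borel_measurable M W u"
    and u01: "AE x in M. x \<in> W \<longrightarrow> 0 \<le> u x \<and> u x \<le> 1"
    and vi: "\<And>A. A \<in> sets M \<Longrightarrow> A \<subseteq> W \<Longrightarrow> 0 \<le> (LINT x:W|M. F x * (indicator A x - u x))"
  shows "AE x in M. x \<in> W \<longrightarrow> (F x < 0 \<longrightarrow> u x = 1) \<and> (F x > 0 \<longrightarrow> u x = 0)"
proof -
  define F' where "F' x = indicator W x * F x" for x
  define u' where "u' x = indicator W x * u x" for x
  have F'_int: "integrable M F'"
    using F unfolding set_integrable_def F'_def by simp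
  then have [measurable]: "F' \<in> borel_measurable M" by auto
  have [measurable]: "u' \<in> borel_measurable M"
    using u unfolding set_borel_measurable_def u'_def by simp
  define A where "A = {x \<in> space M. F' x < 0}"
  have [measurable]: "A \<in> sets M"
    unfolding A_def by measurable
  have "A \<subseteq> W"
    by (auto simp: A_def F'_def indicator_def split: if_splits)
  define G where "G x = - (F' x * (indicator A x - u' x))" for x
  have ae_u': "AE x in M. 0 \<le> u' x \<and> u' x \<le> 1"
    using u01 by eventually_elim (auto simp: u'_def indicator_def)
  \<comment> \<open>Where \<open>F' x < 0\<close>, \<open>G x\<close> is
    \<open>- F' x * (1 - u' x)\<close>; elsewhere it is \<open>F' x * u' x\<close>. Both are
    nonnegative since \<open>u'\<close> lies in [0,1].\<close>
  have G_nonneg: "AE x in M. 0 \<le> G x"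
    using ae_u' AE_space
  proof eventually_elim
    case (elim x) then show ?case
      by (cases "F' x < 0") (auto simp: G_def A_def mult_nonpos_nonneg)
  qed
  have "AE x in M. norm (G x) \<le> norm (F' x)"
    using ae_u' by eventually_elim (auto simp: G_def abs_mult indicator_def intro!: mult_left_le)
  then have G_int: "integrable M G"
    by (rule Bochner_Integration.integrable_bound[OF F'_int, rotated]) (simp add: G_def)
  have "(LINT x|M. G x) = - (LINT x:W|M. F x * (indicator A x - u x))"
    unfolding set_lebesgue_integral_def Bochner_Integration.integral_minus[symmetric]
    by (intro Bochner_Integration.integral_cong) (auto simp: G_def F'_def u'_def indicator_def)
  also have "\<dots> \<le> 0"
    using vi[OF \<open>A \<in> sets M\<close> \<open>A \<subseteq> W\<close>] by simp
  finally have "(LINT x|M. G x) = 0"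
    using integral_nonneg_AE[OF G_nonneg] by simp
  then have "AE x in M. G x = 0"
    using integral_nonneg_eq_0_iff_AE[OF G_int G_nonneg] by simp
  then show ?thesis
    using AE_space
    by eventually_elim (auto simp: G_def F'_def u'_def A_def)
qed

section \<open>Integrability on sets of finite measure\<close>

lemma set_integrable_bounded:
  fixes f :: "'a \<Rightarrow> real"
  assumes "S \<in> fmeasurable M" "set_borel_measurable M S f" "AE x in M. x \<in> S \<longrightarrow> \<bar>f x\<bar> \<le> B"
  shows "set_integrable M S f"
  unfolding set_integrable_def
proof (rule Bochner_Integration.integrable_bound)
  show "integrable M (\<lambda>x. B * indicator S x)"
    using assms(1) by (auto simp: fmeasurable_def top.not_eq_extremum)
  show "AE x in M. norm (indicator S x *\<^sub>R f x) \<le> norm (B * indicator S x)"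
    using assms(3) by eventually_elim (auto simp: indicator_def)
qed (use assms(2) in \<open>simp add: set_borel_measurable_def\<close>)

lemma L2_on_bounded:
  fixes f :: "real^'n::finite \<Rightarrow> real"
  assumes S: "S \<in> lmeasurable" and f: "set_borel_measurable lebesgue S f"
    and "AE x in lebesgue. x \<in> S \<longrightarrow> \<bar>f x\<bar> \<le> B"
  shows "L2_on S f"
  unfolding L2_on_def
proof
  have [measurable]: "(\<lambda>x. indicator S x * f x) \<in> borel_measurable lebesgue"
    using f by (simp add: set_borel_measurable_def)
  have "(\<lambda>x. indicator S x * (f x)\<^sup>2) = (\<lambda>x. (indicator S x * f x)\<^sup>2)"
    by (auto simp: indicator_def)
  then have *: "set_borel_measurable lebesgue S (\<lambda>x. (f x)\<^sup>2)"
    unfolding set_borel_measurable_def by simp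
  show "set_integrable lebesgue S (\<lambda>x. (f x)\<^sup>2)"
    by (rule set_integrable_bounded[OF S *, of "B\<^sup>2"])
      (use assms(3) in \<open>auto elim!: eventually_mono dest: power_mono[where n = 2]\<close>)
qed (rule f)

text \<open>On a set of finite measure the bound \<open>\<bar>t\<bar> \<le> 1 + t\<^sup>2\<close>
  provides an integrable majorant.\<close>

lemma L2_on_imp_set_integrable:
  assumes S: "S \<in> lmeasurable" and f: "L2_on S f"
  shows "set_integrable lebesgue S f"
  unfolding set_integrable_def
proof (rule Bochner_Integration.integrable_bound)
  show "integrable lebesgue (\<lambda>x. indicator S x + indicator S x *\<^sub>R (f x)\<^sup>2)"
    using S f by (intro Bochner_Integration.integrable_add)
      (auto simp: fmeasurable_def L2_on_def set_integrable_def top.not_eq_extremum)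
  have *: "\<bar>t\<bar> \<le> 1 + t\<^sup>2" for t :: real
    using zero_le_power2[of "\<bar>t\<bar> - 1"] zero_le_power2[of t] by (auto simp: power2_diff)
  show "AE x in lebesgue. norm (indicator S x *\<^sub>R f x) \<le> norm (indicator S x + indicator S x *\<^sub>R (f x)\<^sup>2)"
    using * by (auto simp: indicator_def)
qed (use f in \<open>simp add: L2_on_def set_borel_measurable_def\<close>)

lemma L2_on_subset:
  assumes "L2_on S f" "T \<in> sets lebesgue" "T \<subseteq> S"
  shows "L2_on T f"
  using assms set_integrable_subset[of lebesgue S "\<lambda>x. (f x)\<^sup>2" T]
    set_borel_measurable_subset[of lebesgue S f T]
  by (auto simp: L2_on_def)

section \<open>The interaction domain and the nonlocal operator\<close>

text \<open>Adding \<Omega> absorbs the restriction to points outside \<Omega>, leaving a union of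
  translates of \<Omega>. Openness, and with it measurability, then follows whatever the shape of
  the set where \<gamma> is nonzero.\<close>

lemma interaction_union_eq:
  "\<Omega> \<union> interaction_domain \<Omega> \<gamma> = \<Omega> \<union> (\<Union>z\<in>{z. \<gamma> z \<noteq> 0}. (\<lambda>x. x - z) ` \<Omega>)"
proof -
  have "(\<exists>x\<in>\<Omega>. \<gamma> (x - y) \<noteq> 0) \<longleftrightarrow> y \<in> (\<Union>z\<in>{z. \<gamma> z \<noteq> 0}. (\<lambda>x. x - z) ` \<Omega>)" for y
  proof safe
    fix x assume "x \<in> \<Omega>" "\<gamma> (x - y) \<noteq> 0"
    then show "y \<in> (\<Union>z\<in>{z. \<gamma> z \<noteq> 0}. (\<lambda>x. x - z) ` \<Omega>)"
      by (intro UN_I[of "x - y"]) auto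
  next
    fix x z assume "x \<in> \<Omega>" "\<gamma> z \<noteq> 0"
    then show "\<exists>x'\<in>\<Omega>. \<gamma> (x' - (x - z)) \<noteq> 0"
      by (intro bexI[of _ x]) auto
  qed
  then show ?thesis
    unfolding interaction_domain_def by blast
qed

lemma open_interaction_union:
  "open \<Omega> \<Longrightarrow> open (\<Omega> \<union> interaction_domain \<Omega> \<gamma>)"
  unfolding interaction_union_eq by (intro open_Un open_UN ballI open_translation_subtract)

lemma bounded_interaction_union:
  assumes "bounded \<Omega>" "\<And>z. \<gamma> z \<noteq> 0 \<Longrightarrow> norm z \<le> \<delta>"
  shows "bounded (\<Omega> \<union> interaction_domain \<Omega> \<gamma>)"
proof -
  obtain R where R: "\<And>x. x \<in> \<Omega> \<Longrightarrow> norm x \<le> R"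
    using assms(1) by (auto simp: bounded_iff)
  have "norm y \<le> R + \<delta>" if y: "y \<in> interaction_domain \<Omega> \<gamma>" for y
  proof -
    obtain x where "x \<in> \<Omega>" "\<gamma> (x - y) \<noteq> 0"
      using y by (auto simp: interaction_domain_def)
    then show ?thesis
      using R[of x] assms(2)[of "x - y"] norm_triangle_ineq4[of x "x - y"] by simp
  qed
  then have "bounded (interaction_domain \<Omega> \<gamma>)"
    by (rule boundedI)
  then show ?thesis
    using assms(1) by simp
qed

text \<open>For \<open>x\<close> in \<Omega> a nonzero \<open>\<gamma> (x - y)\<close> places
  \<open>y\<close> in \<Omega> or in the interaction domain, so the kernel integrates to the full
  mass \<open>c_gamma \<gamma>\<close>. Integrability of the product with \<open>u\<close> permits
  splitting the integral.\<close>

lemma nonlocal_op_eq: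
  assumes "x \<in> \<Omega>" and \<gamma>: "integrable lebesgue \<gamma>"
    and u: "set_integrable lebesgue (\<Omega> \<union> interaction_domain \<Omega> \<gamma>) (\<lambda>y. \<gamma> (x - y) * u y)"
  shows "nonlocal_op \<Omega> \<gamma> u x = c_gamma \<gamma> * u x - conv \<Omega> \<gamma> u x"
proof -
  let ?S = "\<Omega> \<union> interaction_domain \<Omega> \<gamma>"
  have S: "indicator ?S y * \<gamma> (x - y) = \<gamma> (x - y)" for y
    using \<open>x \<in> \<Omega>\<close> by (auto simp: indicator_def interaction_domain_def)
  have "nonlocal_op \<Omega> \<gamma> u x
      = (LINT y|lebesgue. u x * \<gamma> (x - y) - indicator ?S y *\<^sub>R (\<gamma> (x - y) * u y))"
    unfolding nonlocal_op_def set_lebesgue_integral_def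
    by (intro Bochner_Integration.integral_cong refl, subst (2) S[symmetric]) (simp add: algebra_simps)
  also have "\<dots> = u x * c_gamma \<gamma> - conv \<Omega> \<gamma> u x"
    using integral_lebesgue_reflect[OF \<gamma>, of x] u
    by (subst Bochner_Integration.integral_diff)
      (auto simp: c_gamma_def conv_def set_lebesgue_integral_def set_integrable_def)
  finally show ?thesis by simp
qed

section \<open>The projection formula\<close>

theorem theorem4p2:
  fixes \<Omega> :: "(real^'n::finite) set"
    and \<gamma> :: "real^'n \<Rightarrow> real" and \<gamma>h :: "real \<Rightarrow> real"
    and \<sigma> \<delta> D L \<mu> c\<^sub>F \<beta> \<tau> C\<^sub>m :: real
    and m m' :: "real \<Rightarrow> real"
    and \<theta>k \<theta>km1 uk ukm1 wk :: "real^'n \<Rightarrow> real"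
    and G\<theta>k G\<theta>km1 Gwk :: "real^'n \<Rightarrow> real^'n"
  assumes dim: "CARD('n) \<le> 3"
    and dom: "open \<Omega>" "bounded \<Omega>" "connected \<Omega>" "\<Omega> \<noteq> {}"
    and \<gamma>_nonneg: "\<forall>x. \<gamma> x \<ge> 0"
    and \<gamma>_L1: "integrable lebesgue \<gamma>"
    and \<gamma>_radial: "\<forall>x. \<gamma> x = \<gamma>h (norm x)"
    and \<sigma>_pos: "\<sigma> > 0" and \<delta>_pos: "\<delta> > 0"
    and supp: "{0<..<\<sigma>} \<subseteq> {r. \<gamma>h r \<noteq> 0}" "{r. \<gamma>h r \<noteq> 0} \<subseteq> {0<..\<delta>}"
    and params: "D > 0" "\<mu> > 0" "c\<^sub>F > 0" "\<beta> > 0" "\<tau> > 0"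
    and m_bound: "\<forall>s. \<bar>m s\<bar> \<le> 1/2"
    and m_deriv: "\<forall>s. (m has_real_derivative m' s) (at s) \<and> \<bar>m' s\<bar> \<le> C\<^sub>m"
    and prev: "H1_grad \<Omega> \<theta>km1 G\<theta>km1" "ukm1 \<in> K_set \<Omega> \<gamma>"
    and sol: "H1_grad \<Omega> \<theta>k G\<theta>k" "uk \<in> K_set \<Omega> \<gamma>" "H1_grad \<Omega> wk Gwk"
    and D1: "\<forall>\<phi> G\<phi>. H1_grad \<Omega> \<phi> G\<phi> \<longrightarrow>
               ip \<Omega> (\<lambda>x. \<theta>k x - \<theta>km1 x) \<phi> + D * \<tau> * ip_vec \<Omega> G\<theta>k G\<phi>
               - L * ip \<Omega> (\<lambda>x. uk x - ukm1 x) \<phi> = 0"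
    and D2: "\<forall>\<psi> G\<psi>. H1_grad \<Omega> \<psi> G\<psi> \<longrightarrow>
               \<mu> * ip \<Omega> (\<lambda>x. uk x - ukm1 x) \<psi> + \<tau> * ip \<Omega> wk \<psi>
               + \<beta> * \<tau> * ip_vec \<Omega> Gwk G\<psi> = 0"
    and D3: "\<forall>\<zeta>\<in>K_set \<Omega> \<gamma>.
               ip \<Omega> (\<lambda>x. nonlocal_op \<Omega> \<gamma> uk x - c\<^sub>F * uk x + c\<^sub>F / 2
                          - c\<^sub>F * m (\<theta>km1 x) - wk x) (\<lambda>x. \<zeta> x - uk x) \<ge> 0"
  defines "\<xi> \<equiv> c_gamma \<gamma> - c\<^sub>F"
    and "g \<equiv> (\<lambda>x. wk x + conv \<Omega> \<gamma> uk x + c\<^sub>F * m (\<theta>km1 x) - c\<^sub>F / 2)"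
  shows "(\<xi> > 0 \<longrightarrow>
            (AE x in lebesgue. x \<in> \<Omega> \<longrightarrow>
               uk x = proj01 (g x / \<xi>) \<and>
               uk x = (if g x \<ge> \<xi> then 1 else if g x \<le> 0 then 0 else g x / \<xi>)))
       \<and> (\<xi> = 0 \<longrightarrow>
            (AE x in lebesgue. x \<in> \<Omega> \<longrightarrow>
               (g x > 0 \<longrightarrow> uk x = 1) \<and> (g x < 0 \<longrightarrow> uk x = 0) \<and>
               (g x = 0 \<longrightarrow> 0 \<le> uk x \<and> uk x \<le> 1)))
       \<and> (\<xi> = 0 \<and> {x\<in>\<Omega>. g x = 0} \<in> null_sets lebesgue \<longrightarrow>
            (AE x in lebesgue. x \<in> \<Omega> \<longrightarrow> uk x \<in> {0, 1}))"
proof -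
  define S where "S = \<Omega> \<union> interaction_domain \<Omega> \<gamma>"
  define F where "F x = \<xi> * uk x - g x" for x
  have \<gamma>_support: "norm z \<le> \<delta>" if "\<gamma> z \<noteq> 0" for z
    using that \<gamma>_radial supp(2) by auto
  have S_open: "open S"
    unfolding S_def by (rule open_interaction_union) (rule dom)
  have S_lm: "S \<in> lmeasurable"
    using S_open bounded_interaction_union[OF dom(2) \<gamma>_support] by (simp add: S_def lmeasurable_open)
  have \<Omega>_lm: "\<Omega> \<in> lmeasurable"
    using dom by (simp add: lmeasurable_open)
  have [measurable]: "\<Omega> \<in> sets lebesgue"
    using \<Omega>_lm by (rule fmeasurableD)
  have uk_L2: "L2_on S uk" and uk01: "AE x in lebesgue. x \<in> \<Omega> \<longrightarrow> 0 \<le> uk x \<and> uk x \<le> 1"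
    using sol(2) by (auto simp: K_set_def V_B_def S_def)
  have uk_int: "integrable lebesgue (\<lambda>y. indicator S y * uk y)"
    using L2_on_imp_set_integrable[OF S_lm uk_L2] by (simp add: set_integrable_def)
  have uk_\<Omega>: "L2_on \<Omega> uk"
    using uk_L2 by (rule L2_on_subset) (auto simp: S_def)
  have conv_eq: "conv \<Omega> \<gamma> uk x = (LINT y|lebesgue. \<gamma> (x - y) * (indicator S y * uk y))" for x
    unfolding conv_def set_lebesgue_integral_def S_def[symmetric]
    by (intro Bochner_Integration.integral_cong) auto
  note convolution = integrable_lebesgue_convolution[OF \<gamma>_L1 uk_int]
  \<comment> \<open>Only a.e.: the convolution integrand is integrable for almost every
    \<open>x\<close>, and the operator is split just there.\<close>
  have nonlocal: "AE x in lebesgue. x \<in> \<Omega> \<longrightarrow> nonlocal_op \<Omega> \<gamma> uk x - c\<^sub>F * uk x + c\<^sub>F / 2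
      - c\<^sub>F * m (\<theta>km1 x) - wk x = F x"
    using convolution(1)
  proof eventually_elim
    case (elim x)
    have "set_integrable lebesgue S (\<lambda>y. \<gamma> (x - y) * uk y)"
      using elim by (simp add: set_integrable_def mult.left_commute)
    then show ?case
      using nonlocal_op_eq[OF _ \<gamma>_L1, of x \<Omega> uk]
      by (auto simp: F_def g_def \<xi>_def S_def algebra_simps)
  qed
  have "set_borel_measurable lebesgue \<Omega> (\<lambda>x. m (\<theta>km1 x))"
  proof -
    have "continuous_on UNIV m"
      using m_deriv by (auto intro!: continuous_at_imp_continuous_on DERIV_isCont)
    then have [measurable]: "m \<in> borel_measurable borel"
      by (rule borel_measurable_continuous_onI)
    have [measurable]: "(\<lambda>x. indicator \<Omega> x * \<theta>km1 x) \<in> borel_measurable lebesgue"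
      using prev(1) by (simp add: H1_grad_def L2_on_def set_borel_measurable_def)
    \<comment> \<open>Since \<open>\<theta>km1\<close> is measurable only on \<Omega>, it is first
      cut off to zero; the value \<open>m 0\<close> this creates outside \<Omega> is removed by the
      outer indicator.\<close>
    have "(\<lambda>x. indicator \<Omega> x *\<^sub>R m (\<theta>km1 x)) = (\<lambda>x. indicator \<Omega> x * m (indicator \<Omega> x * \<theta>km1 x))"
      by (auto simp: indicator_def)
    then show ?thesis
      unfolding set_borel_measurable_def by simp
  qed
  then have m_int: "set_integrable lebesgue \<Omega> (\<lambda>x. m (\<theta>km1 x))"
    using m_bound by (intro set_integrable_bounded[OF \<Omega>_lm, where B = "1/2"]) auto
  have const_int: "set_integrable lebesgue \<Omega> (\<lambda>x. c\<^sub>F / 2)"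
    using set_integrable_bounded[OF \<Omega>_lm, of "\<lambda>x. c\<^sub>F / 2" "\<bar>c\<^sub>F / 2\<bar>"]
    by (auto simp: set_borel_measurable_def)
  have conv_int: "set_integrable lebesgue \<Omega> (conv \<Omega> \<gamma> uk)"
    unfolding set_integrable_def
    using convolution(2) by (intro integrable_mult_indicator) (simp_all add: conv_eq[abs_def])
  have wk_int: "set_integrable lebesgue \<Omega> wk"
    using sol(3) by (intro L2_on_imp_set_integrable[OF \<Omega>_lm]) (simp add: H1_grad_def)
  have F_int: "set_integrable lebesgue \<Omega> F"
    unfolding F_def[abs_def] g_def
    using wk_int conv_int m_int const_int L2_on_imp_set_integrable[OF \<Omega>_lm uk_\<Omega>]
    by (intro set_integral_diff set_integral_add set_integrable_mult_right)
  have compl: "AE x in lebesgue. x \<in> \<Omega> \<longrightarrow> (F x < 0 \<longrightarrow> uk x = 1) \<and> (F x > 0 \<longrightarrow> uk x = 0)"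
  proof (rule complementarity_of_variational_inequality[OF _ F_int _ uk01])
    show uk_meas: "set_borel_measurable lebesgue \<Omega> uk"
      using uk_\<Omega> by (simp add: L2_on_def)
    fix A :: "(real^'n) set"
    assume A [measurable]: "A \<in> sets lebesgue" and "A \<subseteq> \<Omega>"
    have [measurable]: "S \<in> sets borel" "\<Omega> \<in> sets borel"
      using S_open dom(1) by auto
    \<comment> \<open>The indicator of \<open>A\<close> prescribes the values on \<Omega>; the
      extension supplies values on the interaction domain that make it a member of
      \<open>K_set \<Omega> \<gamma>\<close>.\<close>
    obtain v where v: "v \<in> borel_measurable borel" and v01: "\<And>x. 0 \<le> v x \<and> v x \<le> 1"
      and v\<Omega>: "AE x in lebesgue. x \<in> \<Omega> \<longrightarrow> v x = indicator A x"
      and vN: "\<And>x. x \<notin> \<Omega> \<Longrightarrow> (LINT y:S|lebesgue. (v x - v y) * \<gamma> (x - y)) = 0"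
      by (rule neumann_extension_lebesgue[where S = S and W = \<Omega> and k = \<gamma> and \<eta> = "indicator A"])
        (use \<gamma>_L1 \<gamma>_nonneg in \<open>auto simp: indicator_def\<close>)
    have v_leb [measurable]: "v \<in> borel_measurable lebesgue"
      using v by (intro measurable_completion) simp
    have "L2_on S v"
      using S_lm v01 by (intro L2_on_bounded[where B = 1])
        (auto simp: set_borel_measurable_def intro!: borel_measurable_times borel_measurable_indicator)
    moreover have "nonlocal_op \<Omega> \<gamma> v x = 0" if "x \<in> interaction_domain \<Omega> \<gamma>" for x
      using vN[of x] that by (simp add: interaction_domain_def nonlocal_op_def S_def)
    ultimately have "v \<in> K_set \<Omega> \<gamma>"
      using v01 by (simp add: K_set_def V_B_def S_def)
    then have "0 \<le> ip \<Omega> (\<lambda>x. nonlocal_op \<Omega> \<gamma> uk x - c\<^sub>F * uk x + c\<^sub>F / 2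
                          - c\<^sub>F * m (\<theta>km1 x) - wk x) (\<lambda>x. v x - uk x)"
      using D3 by blast
    also have "\<dots> = (LINT x:\<Omega>|lebesgue. F x * (indicator A x - uk x))"
      unfolding ip_def set_lebesgue_integral_def
    proof (rule integral_cong_AE)
      have [measurable]: "(\<lambda>x. indicator \<Omega> x * F x) \<in> borel_measurable lebesgue"
        "(\<lambda>x. indicator \<Omega> x * uk x) \<in> borel_measurable lebesgue"
        using F_int uk_meas by (auto simp: set_integrable_def set_borel_measurable_def)
      have "(\<lambda>x. indicator \<Omega> x *\<^sub>R (F x * (indicator A x - uk x)))
          = (\<lambda>x. (indicator \<Omega> x * F x) * (indicator A x - indicator \<Omega> x * uk x))"
        by (auto simp: indicator_def)
      then show rhs: "(\<lambda>x. indicator \<Omega> x *\<^sub>R (F x * (indicator A x - uk x))) \<in> borel_measurable lebesgue"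
        by simp
      show ae: "AE x in lebesgue. indicator \<Omega> x *\<^sub>R ((nonlocal_op \<Omega> \<gamma> uk x - c\<^sub>F * uk x + c\<^sub>F / 2
          - c\<^sub>F * m (\<theta>km1 x) - wk x) * (v x - uk x)) = indicator \<Omega> x *\<^sub>R (F x * (indicator A x - uk x))"
        using nonlocal v\<Omega> by eventually_elim (auto simp: indicator_def)
      \<comment> \<open>Measurability is inherited from the a.e. equal right-hand side, because
        Lebesgue measure is complete.\<close>
      show "(\<lambda>x. indicator \<Omega> x *\<^sub>R ((nonlocal_op \<Omega> \<gamma> uk x - c\<^sub>F * uk x + c\<^sub>F / 2
          - c\<^sub>F * m (\<theta>km1 x) - wk x) * (v x - uk x))) \<in> borel_measurable lebesgue"
        by (rule borel_measurable_AE[OF rhs]) (rule eventually_mono[OF ae], rule sym)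
    qed
    finally show "0 \<le> (LINT x:\<Omega>|lebesgue. F x * (indicator A x - uk x))" .
  qed simp
  have pos: "AE x in lebesgue. x \<in> \<Omega> \<longrightarrow>
      uk x = proj01 (g x / \<xi>) \<and> uk x = (if g x \<ge> \<xi> then 1 else if g x \<le> 0 then 0 else g x / \<xi>)"
    if "\<xi> > 0"
    using compl uk01
  proof eventually_elim
    case (elim x)
    show ?case
    proof
      assume "x \<in> \<Omega>"
      then have u: "0 \<le> uk x" "uk x \<le> 1" "F x < 0 \<Longrightarrow> uk x = 1" "F x > 0 \<Longrightarrow> uk x = 0"
        using elim by auto
      \<comment> \<open>If \<open>F x < 0\<close>, then \<open>uk x = 1\<close> and
        \<open>g x > \<xi>\<close>; if \<open>F x > 0\<close>, then \<open>uk x = 0\<close> and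
        \<open>g x < 0\<close>. If \<open>F x = 0\<close>, the bounds on
        \<open>uk x = g x / \<xi>\<close> place \<open>g x\<close> between 0 and \<xi>, and at both
        endpoints the quotient agrees with the constant branches.\<close>
      consider "F x < 0" | "F x > 0" | "F x = 0" by linarith
      then have "uk x = (if g x \<ge> \<xi> then 1 else if g x \<le> 0 then 0 else g x / \<xi>)"
      proof cases
        case 1
        then show ?thesis
          using u(3)[OF 1] by (simp add: F_def)
      next
        case 2
        then show ?thesis
          using u(4)[OF 2] that by (simp add: F_def)
      next
        case 3
        then have "uk x = g x / \<xi>"
          using that by (simp add: F_def field_simps)
        moreover have "g x / \<xi> \<le> 0" if "g x \<le> 0"
          using that \<open>\<xi> > 0\<close> by (simp add: divide_le_0_iff)
        moreover have "1 \<le> g x / \<xi>" if "\<xi> \<le> g x"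
          using that \<open>\<xi> > 0\<close> by simp
        ultimately show ?thesis
          using u(1,2) by simp
      qed
      moreover have "proj01 (g x / \<xi>) = (if g x \<ge> \<xi> then 1 else if g x \<le> 0 then 0 else g x / \<xi>)"
        using that by (auto simp: proj01_def min_def max_def divide_simps)
      ultimately show "uk x = proj01 (g x / \<xi>)
          \<and> uk x = (if g x \<ge> \<xi> then 1 else if g x \<le> 0 then 0 else g x / \<xi>)"
        by simp
    qed
  qed
  \<comment> \<open>Here \<open>F x = - g x\<close>, so the sign conditions on \<open>F\<close> are
    those on \<open>g\<close> reversed.\<close>
  have zero: "AE x in lebesgue. x \<in> \<Omega> \<longrightarrow> (g x > 0 \<longrightarrow> uk x = 1) \<and> (g x < 0 \<longrightarrow> uk x = 0) \<and>
      (g x = 0 \<longrightarrow> 0 \<le> uk x \<and> uk x \<le> 1)" if "\<xi> = 0"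
    using compl uk01 by eventually_elim (use that in \<open>auto simp: F_def\<close>)
  have null: "AE x in lebesgue. x \<in> \<Omega> \<longrightarrow> uk x \<in> {0, 1}"
    if "\<xi> = 0" and "{x\<in>\<Omega>. g x = 0} \<in> null_sets lebesgue"
    using zero[OF that(1)] AE_not_in[OF that(2)]
    by eventually_elim (simp, linarith)
  show ?thesis
    using pos zero null by blast
qed

end
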